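(* Let $G$ be a finite nonabelian group. Let $\alpha=\theta_{xy}$, $\beta\in\{\theta_{xy},\theta_{yx},\theta_{yx^{-1}},\theta_{x^{-1}y}\}$, $\gamma\in\{\theta_{xy},\theta_{yx}\}$, let $\delta$ be any of the eight multiplications $\theta_{xy},\theta_{xy^{-1}},\theta_{x^{-1}y},\theta_{x^{-1}y^{-1}},\theta_{yx},\theta_{yx^{-1}},\theta_{y^{-1}x},\theta_{y^{-1}x^{-1}}$, and let $(M,* )=G(\alpha,\beta,\gamma,\delta)$. (1) $(M,* )$ is a group if and only if it equals $G(\theta_{xy},\theta_{xy},\theta_{xy},\theta_{xy})$. (2) $(M,* )$ is a nonassociative Moufang loop if and only if it equals $G(\theta_{xy},\theta_{x^{-1}y},\theta_{yx},\theta_{yx^{-1}})$, and then it is isomorphic to the Chein loop $M(G,2)$. (3) $(M,* )$ is a left Bol loop that is not Moufang if and only if one of the following holds: (A) $G^2\subseteq Z(G)$ and $(M,* )$ is one of $G(\theta_{xy},\theta_{x^{-1}y},\theta_{xy},\theta_{x^{-1}y})$, $G(\theta_{xy},\theta_{xy},\theta_{yx},\theta_{yx})$; (B) $G^2\subseteq Z(G)$, $G^4=1$, and $(M,* )$ is one of $G(\theta_{xy},\theta_{xy},\theta_{xy},\theta_{x^{-1}y})$, $G(\theta_{xy},\theta_{xy},\theta_{yx},\theta_{yx^{-1}})$, $G(\theta_{xy},\theta_{x^{-1}y},\theta_{xy},\theta_{xy})$, $G(\theta_{xy},\theta_{x^{-1}y},\theta_{yx},\theta_{yx})$.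
   Context: For a group $G$ and a word $uv$ among $xy$, $xy^{-1}$, $x^{-1}y$, $x^{-1}y^{-1}$, $yx$, $yx^{-1}$, $y^{-1}x$, $y^{-1}x^{-1}$, the symbol $\theta_{uv}$ denotes the multiplication $G\times G\to G$ sending $(a,b)$ to the value in $G$ of the word $uv$ at $x=a$, $y=b$ (e.g. $\theta_{y^{-1}x}(a,b)=b^{-1}a$). Let $\overline{G}=\{\overline g : g\in G\}$ be a disjoint copy of $G$. For four such multiplications $\alpha,\beta,\gamma,\delta$, $G(\alpha,\beta,\gamma,\delta)$ denotes the set $G\cup\overline{G}$ with the operation, for $g,h\in G$, $$g*h=\alpha(g,h),\quad g*\overline{h}=\overline{\beta(g,h)},\quad \overline{g}*h=\overline{\gamma(g,h)},\quad \overline{g}*\overline{h}=\delta(g,h).$$ It is a quasigroup. The Chein loop is $M(G,2)=G(\theta_{xy},\theta_{yx},\theta_{xy^{-1}},\theta_{y^{-1}x})$. A loop is left Bol if it satisfies $x(y(xz))=(x(yx))z$; it is Moufang if it satisfies $x(y(xz))=((xy)x)z$ (equivalently, it is both left and right Bol). For a positive integer $m$, $G^m=\{g^m : g\in G\}$ (a set); $G^4=1$ means $g^4=1$ for all $g\in G$. $Z(G)$ is the center of $G$. *)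

theory Defs
  imports "HOL-Algebra.Group"
begin

text \<open>
  The eight words: the constructors spell the word, with an \<open>i\<close> after a letter denoting
  its inverse; e.g. \<open>YiX\<close> is $y^{-1}x$.
\<close>

datatype word = XY | XYi | XiY | XiYi | YX | YXi | YiX | YiXi

primrec theta :: "('a, 'b) monoid_scheme \<Rightarrow> word \<Rightarrow> 'a \<Rightarrow> 'a \<Rightarrow> 'a" where
  "theta G XY = (\<lambda>a b. a \<otimes>\<^bsub>G\<^esub> b)"
| "theta G XYi = (\<lambda>a b. a \<otimes>\<^bsub>G\<^esub> inv\<^bsub>G\<^esub> b)"
| "theta G XiY = (\<lambda>a b. inv\<^bsub>G\<^esub> a \<otimes>\<^bsub>G\<^esub> b)"
| "theta G XiYi = (\<lambda>a b. inv\<^bsub>G\<^esub> a \<otimes>\<^bsub>G\<^esub> inv\<^bsub>G\<^esub> b)"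
| "theta G YX = (\<lambda>a b. b \<otimes>\<^bsub>G\<^esub> a)"
| "theta G YXi = (\<lambda>a b. b \<otimes>\<^bsub>G\<^esub> inv\<^bsub>G\<^esub> a)"
| "theta G YiX = (\<lambda>a b. inv\<^bsub>G\<^esub> b \<otimes>\<^bsub>G\<^esub> a)"
| "theta G YiXi = (\<lambda>a b. inv\<^bsub>G\<^esub> b \<otimes>\<^bsub>G\<^esub> inv\<^bsub>G\<^esub> a)"

text \<open>
  \<open>Inl g\<close> is the element $g$ of $G$ and \<open>Inr g\<close> the element $\overline{g}$ of the
  disjoint copy. The operation is \<open>undefined\<close> off the carrier, so that equality of two such
  records means exactly that the operations agree on $G\cup\overline{G}$. The \<open>one\<close> field
  is a choice: for general multiplications there need not be a neutral element, but if there is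
  a neutral element when $\alpha=\theta_{xy}$, it can only be the identity of $G$.
\<close>

fun doubling_mult ::
  "('a \<Rightarrow> 'a \<Rightarrow> 'a) \<Rightarrow> ('a \<Rightarrow> 'a \<Rightarrow> 'a) \<Rightarrow> ('a \<Rightarrow> 'a \<Rightarrow> 'a) \<Rightarrow> ('a \<Rightarrow> 'a \<Rightarrow> 'a)
    \<Rightarrow> 'a + 'a \<Rightarrow> 'a + 'a \<Rightarrow> 'a + 'a" where
  "doubling_mult \<alpha> \<beta> \<gamma> \<delta> (Inl g) (Inl h) = Inl (\<alpha> g h)"
| "doubling_mult \<alpha> \<beta> \<gamma> \<delta> (Inl g) (Inr h) = Inr (\<beta> g h)"
| "doubling_mult \<alpha> \<beta> \<gamma> \<delta> (Inr g) (Inl h) = Inr (\<gamma> g h)"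
| "doubling_mult \<alpha> \<beta> \<gamma> \<delta> (Inr g) (Inr h) = Inl (\<delta> g h)"

definition doubling ::
  "('a, 'b) monoid_scheme \<Rightarrow> ('a \<Rightarrow> 'a \<Rightarrow> 'a) \<Rightarrow> ('a \<Rightarrow> 'a \<Rightarrow> 'a) \<Rightarrow> ('a \<Rightarrow> 'a \<Rightarrow> 'a)
    \<Rightarrow> ('a \<Rightarrow> 'a \<Rightarrow> 'a) \<Rightarrow> ('a + 'a) monoid" where
  "doubling G \<alpha> \<beta> \<gamma> \<delta> =
    (let S = carrier G <+> carrier G in
      \<lparr>carrier = S,
       mult = (\<lambda>u v. if u \<in> S \<and> v \<in> S then doubling_mult \<alpha> \<beta> \<gamma> \<delta> u v else undefined),
       one = Inl \<one>\<^bsub>G\<^esub>\<rparr>)"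

abbreviation doubling_words ::
  "('a, 'b) monoid_scheme \<Rightarrow> word \<Rightarrow> word \<Rightarrow> word \<Rightarrow> word \<Rightarrow> ('a + 'a) monoid" where
  "doubling_words G p q r s \<equiv> doubling G (theta G p) (theta G q) (theta G r) (theta G s)"

definition chein_loop :: "('a, 'b) monoid_scheme \<Rightarrow> ('a + 'a) monoid" where
  "chein_loop G = doubling_words G XY YX XYi YiX"

definition quasigroup :: "('a, 'b) monoid_scheme \<Rightarrow> bool" where
  "quasigroup Q \<longleftrightarrow>
    (\<forall>a\<in>carrier Q. \<forall>b\<in>carrier Q. a \<otimes>\<^bsub>Q\<^esub> b \<in> carrier Q) \<and>
    (\<forall>a\<in>carrier Q. \<forall>b\<in>carrier Q. \<exists>!x. x \<in> carrier Q \<and> a \<otimes>\<^bsub>Q\<^esub> x = b) \<and>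
    (\<forall>a\<in>carrier Q. \<forall>b\<in>carrier Q. \<exists>!y. y \<in> carrier Q \<and> y \<otimes>\<^bsub>Q\<^esub> a = b)"

definition is_loop :: "('a, 'b) monoid_scheme \<Rightarrow> bool" where
  "is_loop Q \<longleftrightarrow> quasigroup Q \<and> \<one>\<^bsub>Q\<^esub> \<in> carrier Q \<and>
    (\<forall>a\<in>carrier Q. \<one>\<^bsub>Q\<^esub> \<otimes>\<^bsub>Q\<^esub> a = a \<and> a \<otimes>\<^bsub>Q\<^esub> \<one>\<^bsub>Q\<^esub> = a)"

definition left_bol_loop :: "('a, 'b) monoid_scheme \<Rightarrow> bool" where
  "left_bol_loop Q \<longleftrightarrow> is_loop Q \<and>
    (\<forall>x\<in>carrier Q. \<forall>y\<in>carrier Q. \<forall>z\<in>carrier Q.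
      x \<otimes>\<^bsub>Q\<^esub> (y \<otimes>\<^bsub>Q\<^esub> (x \<otimes>\<^bsub>Q\<^esub> z)) = (x \<otimes>\<^bsub>Q\<^esub> (y \<otimes>\<^bsub>Q\<^esub> x)) \<otimes>\<^bsub>Q\<^esub> z)"

definition moufang_loop :: "('a, 'b) monoid_scheme \<Rightarrow> bool" where
  "moufang_loop Q \<longleftrightarrow> is_loop Q \<and>
    (\<forall>x\<in>carrier Q. \<forall>y\<in>carrier Q. \<forall>z\<in>carrier Q.
      x \<otimes>\<^bsub>Q\<^esub> (y \<otimes>\<^bsub>Q\<^esub> (x \<otimes>\<^bsub>Q\<^esub> z)) = ((x \<otimes>\<^bsub>Q\<^esub> y) \<otimes>\<^bsub>Q\<^esub> x) \<otimes>\<^bsub>Q\<^esub> z)"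

definition associative :: "('a, 'b) monoid_scheme \<Rightarrow> bool" where
  "associative Q \<longleftrightarrow>
    (\<forall>x\<in>carrier Q. \<forall>y\<in>carrier Q. \<forall>z\<in>carrier Q.
      (x \<otimes>\<^bsub>Q\<^esub> y) \<otimes>\<^bsub>Q\<^esub> z = x \<otimes>\<^bsub>Q\<^esub> (y \<otimes>\<^bsub>Q\<^esub> z))"

definition center :: "('a, 'b) monoid_scheme \<Rightarrow> 'a set" where
  "center G = {z \<in> carrier G. \<forall>g\<in>carrier G. z \<otimes>\<^bsub>G\<^esub> g = g \<otimes>\<^bsub>G\<^esub> z}"

text \<open>The set of $m$-th powers, not the subgroup they generate.\<close>

definition powers :: "('a, 'b) monoid_scheme \<Rightarrow> nat \<Rightarrow> 'a set" where
  "powers G m = (\<lambda>g. g [^]\<^bsub>G\<^esub> m) ` carrier G"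

end

theory Submission
  imports Defs
begin

text \<open>
  The left Bol identity amounts to six word equations in $x,y,z \in G$, and setting some of the
  variables to $1$ already decides almost everything. With $x = y = 1$ in the equation for
  $(\overline x, y, z)$ a wrong $\delta$ forces $z^{-1} = z$; with $x = 1$ the same equation forces
  $\beta \in \{\theta_{xy}, \theta_{x^{-1}y}\}$, and the one for $(\overline x, \overline y, z)$ forces
  $\gamma$ and $\delta$ to multiply their second argument on the same side. Each of the eight
  remaining operations is a group, a Chein loop, or satisfies the identity exactly under the stated
  conditions on $G^2$ and $G^4$; as Moufang loops are the flexible left Bol loops, failure of
  $(xy)x = x(yx)$ shows that the last six are not Moufang. The isomorphism with the Chein loop is
  $g \mapsto g$, $\overline g \mapsto \overline{g^{-1}}$.
\<close>

section \<open>Quantifiers over a disjoint sum\<close>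

lemma ball_Plus: "(\<forall>u\<in>A <+> B. P u) \<longleftrightarrow> (\<forall>a\<in>A. P (Inl a)) \<and> (\<forall>b\<in>B. P (Inr b))"
  by auto

lemma bex_Plus: "(\<exists>u\<in>A <+> B. P u) \<longleftrightarrow> (\<exists>a\<in>A. P (Inl a)) \<or> (\<exists>b\<in>B. P (Inr b))"
  by auto

text \<open>A unique solution lies in one of the two halves, and the other half then contains none;
  this reduces the quasigroup property to \<open>theta_latin\<close>.\<close>

lemma ex1_Plus:
  "(\<exists>!u. u \<in> A <+> B \<and> P u) \<longleftrightarrow>
    ((\<exists>!a. a \<in> A \<and> P (Inl a)) \<and> (\<forall>b\<in>B. \<not> P (Inr b))) \<or>
    ((\<exists>!b. b \<in> B \<and> P (Inr b)) \<and> (\<forall>a\<in>A. \<not> P (Inl a)))"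
  unfolding Ex1_def split_sum_all split_sum_ex by auto

context group
begin

section \<open>Unique solvability and the neutral element\<close>

lemma inv_cancel_left [simp]:
  assumes "x \<in> carrier G" "y \<in> carrier G"
  shows "inv x \<otimes> (x \<otimes> y) = y" "x \<otimes> (inv x \<otimes> y) = y"
  using assms by (simp_all flip: m_assoc)

lemma theta_closed [simp]:
  assumes "x \<in> carrier G" "y \<in> carrier G"
  shows "theta G w x y \<in> carrier G"
  using assms by (cases w) auto

lemma ex1_mult_left:
  assumes "a \<in> carrier G" "b \<in> carrier G"
  shows "\<exists>!x. x \<in> carrier G \<and> a \<otimes> x = b"
  using assms by (intro ex1I[of _ "inv a \<otimes> b"]) auto

lemma ex1_mult_right:
  assumes "a \<in> carrier G" "b \<in> carrier G"
  shows "\<exists>!x. x \<in> carrier G \<and> x \<otimes> a = b"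
  using assms by (intro ex1I[of _ "b \<otimes> inv a"]) (auto simp: m_assoc)

text \<open>Inversion permutes the carrier, so words that invert the unknown inherit unique
  solvability from the plain products.\<close>

lemma ex1_inv:
  assumes "\<exists>!x. x \<in> carrier G \<and> P x"
  shows "\<exists>!x. x \<in> carrier G \<and> P (inv x)"
  using assms by (metis inv_closed inv_inv)

lemma theta_latin:
  assumes "a \<in> carrier G" "b \<in> carrier G"
  shows "\<exists>!x. x \<in> carrier G \<and> theta G w a x = b"
    and "\<exists>!x. x \<in> carrier G \<and> theta G w x a = b"
  using assms
  by (cases w; simp add: ex1_mult_left ex1_mult_right
        ex1_inv[where P = "\<lambda>x. c \<otimes> x = d" for c d] ex1_inv[where P = "\<lambda>x. x \<otimes> c = d" for c d])+

lemma carrier_doubling: "carrier (doubling G \<alpha> \<beta> \<gamma> \<delta>) = carrier G <+> carrier G"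
  by (simp add: doubling_def Let_def)

lemma one_doubling: "\<one>\<^bsub>doubling G \<alpha> \<beta> \<gamma> \<delta>\<^esub> = Inl \<one>"
  by (simp add: doubling_def Let_def)

lemma mult_doubling:
  assumes "g \<in> carrier G" "h \<in> carrier G"
  shows "Inl g \<otimes>\<^bsub>doubling G \<alpha> \<beta> \<gamma> \<delta>\<^esub> Inl h = Inl (\<alpha> g h)"
    and "Inl g \<otimes>\<^bsub>doubling G \<alpha> \<beta> \<gamma> \<delta>\<^esub> Inr h = Inr (\<beta> g h)"
    and "Inr g \<otimes>\<^bsub>doubling G \<alpha> \<beta> \<gamma> \<delta>\<^esub> Inl h = Inr (\<gamma> g h)"
    and "Inr g \<otimes>\<^bsub>doubling G \<alpha> \<beta> \<gamma> \<delta>\<^esub> Inr h = Inl (\<delta> g h)"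
  using assms by (auto simp: doubling_def Let_def)

lemmas doubling_simps = carrier_doubling one_doubling mult_doubling ball_Plus

lemma quasigroup_doubling_words: "quasigroup (doubling_words G p q r s)"
  unfolding quasigroup_def
  by (simp add: doubling_simps ex1_Plus theta_latin InlI InrI cong: conj_cong)

text \<open>The restrictions on \<open>q\<close> and \<open>r\<close> enter here: they keep the
  identity of G neutral on the second copy.\<close>

lemma is_loop_doubling_words:
  assumes "q \<in> {XY, YX, YXi, XiY}" "r \<in> {XY, YX}"
  shows "is_loop (doubling_words G XY q r s)"
proof -
  have "theta G q \<one> h = h" "theta G r h \<one> = h" if "h \<in> carrier G" for h
    using assms that by auto
  then show ?thesis
    unfolding is_loop_def by (simp add: quasigroup_doubling_words[of XY, simplified] doubling_simps InlI)
qed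

text \<open>The conjuncts belong, in order, to the patterns (x, y', z), (x, y', z'), (x', y, z),
  (x', y, z'), (x', y', z), (x', y', z'), where a prime marks an element of the second copy. The
  other two patterns always hold.\<close>

lemma left_bol_doubling_words_iff:
  assumes "q \<in> {XY, YX, YXi, XiY}" "r \<in> {XY, YX}"
  shows "left_bol_loop (doubling_words G XY q r s) \<longleftrightarrow>
    (\<forall>x\<in>carrier G. \<forall>y\<in>carrier G. \<forall>z\<in>carrier G.
      theta G q x (theta G r y (x \<otimes> z)) = theta G r (theta G q x (theta G r y x)) z \<and>
      x \<otimes> theta G s y (theta G q x z) = theta G s (theta G q x (theta G r y x)) z \<and>
      theta G s x (theta G q y (theta G r x z)) = theta G s x (theta G q y x) \<otimes> z \<and>
      theta G r x (y \<otimes> theta G s x z) = theta G q (theta G s x (theta G q y x)) z \<and>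
      theta G r x (theta G s y (theta G r x z)) = theta G r (theta G r x (theta G s y x)) z \<and>
      theta G s x (theta G r y (theta G s x z)) = theta G s (theta G r x (theta G s y x)) z)"
proof -
  \<comment> \<open>Pattern (x, y, z'): the word xyx is a palindrome, so on either side, multiplying
    by x, y, x in turn is multiplying by xyx, and multiplying by their inverses in turn is
    multiplying by its inverse.\<close>
  have "theta G q x (theta G q y (theta G q x z)) = theta G q (x \<otimes> (y \<otimes> x)) z"
    if "x \<in> carrier G" "y \<in> carrier G" "z \<in> carrier G" for x y z
    using that assms(1) by (auto simp: m_assoc inv_mult_group)
  moreover have "x \<otimes> (y \<otimes> (x \<otimes> z)) = x \<otimes> (y \<otimes> x) \<otimes> z"
    if "x \<in> carrier G" "y \<in> carrier G" "z \<in> carrier G" for x y z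
    using that by (simp add: m_assoc)
  ultimately show ?thesis
    unfolding left_bol_loop_def
    by (simp add: is_loop_doubling_words[OF assms, unfolded theta.simps(1)] doubling_simps ball_conj_distrib conj_ac)
qed

section \<open>Noncommutativity and the conditions on squares and fourth powers\<close>

lemma ex_noncommuting:
  assumes "\<not> comm_group G"
  obtains a b where "a \<in> carrier G" "b \<in> carrier G" "a \<otimes> b \<noteq> b \<otimes> a"
  using assms group_comm_groupI by metis

text \<open>If every element were its own inverse, then ab = (ab)^-1 = b^-1 a^-1 = ba.\<close>

lemma ex_not_involution:
  assumes "\<not> comm_group G"
  obtains a where "a \<in> carrier G" "inv a \<noteq> a"
proof (rule ccontr)
  assume "\<not> thesis"
  then have inv: "inv x = x" if "x \<in> carrier G" for x
    using that \<open>\<And>a. a \<in> carrier G \<Longrightarrow> inv a \<noteq> a \<Longrightarrow> thesis\<close> by blast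
  obtain a b where "a \<in> carrier G" "b \<in> carrier G" "a \<otimes> b \<noteq> b \<otimes> a"
    using ex_noncommuting[OF assms] .
  then show False
    using inv_mult_group[of a b] by (simp add: inv)
qed

text \<open>Both sides are bracketed to the right, as \<open>m_assoc\<close> leaves the word
  equations.\<close>

lemma powers_2_subset_center_iff:
  "powers G 2 \<subseteq> center G \<longleftrightarrow>
    (\<forall>x\<in>carrier G. \<forall>y\<in>carrier G. x \<otimes> (x \<otimes> y) = y \<otimes> (x \<otimes> x))"
  unfolding powers_def center_def by (auto simp: numeral_2_eq_2 m_assoc)

lemma powers_4_eq_one_iff:
  "powers G 4 = {\<one>} \<longleftrightarrow> (\<forall>x\<in>carrier G. x \<otimes> x = inv x \<otimes> inv x)"
proof -
  have "x [^] (4::nat) = \<one> \<longleftrightarrow> x \<otimes> x = inv x \<otimes> inv x" if "x \<in> carrier G" for x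
  proof -
    have "x [^] (4::nat) = (x \<otimes> x) \<otimes> (x \<otimes> x)"
      using that by (simp add: eval_nat_numeral m_assoc)
    moreover have "(x \<otimes> x) \<otimes> (x \<otimes> x) = \<one> \<longleftrightarrow> x \<otimes> x = inv (x \<otimes> x)"
      using that by (metis inv_equality m_closed r_inv)
    ultimately show ?thesis
      using that by (simp add: inv_mult_group)
  qed
  \<comment> \<open>The set contains 1 = 1^4, so only one inclusion carries information.\<close>
  moreover have "powers G 4 = {\<one>} \<longleftrightarrow> (\<forall>x\<in>carrier G. x [^] (4::nat) = \<one>)"
    unfolding powers_def using one_closed by (auto simp: set_eq_iff image_iff intro!: exI[of _ \<one>])
  ultimately show ?thesis
    by blast
qed

section \<open>Words excluded by the left Bol identity\<close>

lemma left_bol_doubling_words_imp: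
  assumes nonab: "\<not> comm_group G"
    and q: "q \<in> {XY, YX, YXi, XiY}" and r: "r \<in> {XY, YX}"
    and bol: "left_bol_loop (doubling_words G XY q r s)"
  shows "q \<in> {XY, XiY} \<and> (r = XY \<and> s \<in> {XY, XiY} \<or> r = YX \<and> s \<in> {YX, YXi})"
proof -
  obtain a b where ab: "a \<in> carrier G" "b \<in> carrier G" "a \<otimes> b \<noteq> b \<otimes> a"
    using ex_noncommuting[OF nonab] .
  obtain c where c: "c \<in> carrier G" "inv c \<noteq> c"
    using ex_not_involution[OF nonab] .
  note bol' = bol[unfolded left_bol_doubling_words_iff[OF q r], rule_format]
  have bol1: "theta G s \<one> (theta G q y (theta G r \<one> z)) = theta G s \<one> (theta G q y \<one>) \<otimes> z"
    if "y \<in> carrier G" "z \<in> carrier G" for y z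
    using bol'[OF one_closed that] by blast
  have bol2: "theta G r \<one> (theta G s y (theta G r \<one> z)) = theta G r (theta G r \<one> (theta G s y \<one>)) z"
    if "y \<in> carrier G" "z \<in> carrier G" for y z
    using bol'[OF one_closed that] by blast
  have s: "s \<in> {XY, XiY, YX, YXi}"
    using bol1[of \<one> c] c q r by (cases s) auto
  \<comment> \<open>With \<open>s\<close> restricted, \<open>bol1\<close> reads
    \<open>theta G q y z = theta G q y \<one> \<otimes> z\<close>. Taking y = \<open>inv a\<close>
    turns the case \<open>YXi\<close> into ba = ab; the same choice serves \<open>YXi\<close> as a
    value of \<open>s\<close> in \<open>bol2\<close>.\<close>
  have q': "q \<in> {XY, XiY}"
    using bol1[of a b] bol1[of "inv a" b] ab q r s by auto
  show ?thesis
    using bol2[of a b] bol2[of "inv a" b] ab q' r s by auto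
qed

section \<open>Sufficiency and necessity of the power conditions\<close>

lemma left_bol_if_squares_central:
  assumes "powers G 2 \<subseteq> center G"
  shows "left_bol_loop (doubling_words G XY XiY XY XiY)"
    and "left_bol_loop (doubling_words G XY XY YX YX)"
    and "powers G 4 = {\<one>} \<Longrightarrow> left_bol_loop (doubling_words G XY XY XY XiY)"
    and "powers G 4 = {\<one>} \<Longrightarrow> left_bol_loop (doubling_words G XY XY YX YXi)"
    and "powers G 4 = {\<one>} \<Longrightarrow> left_bol_loop (doubling_words G XY XiY XY XY)"
    and "powers G 4 = {\<one>} \<Longrightarrow> left_bol_loop (doubling_words G XY XiY YX YX)"
proof -
  have sq: "y \<otimes> (x \<otimes> x) = x \<otimes> (x \<otimes> y)" if "x \<in> carrier G" "y \<in> carrier G" for x y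
    using that assms[unfolded powers_2_subset_center_iff] by metis
  have shift: "y \<otimes> (x \<otimes> (x \<otimes> z)) = x \<otimes> (x \<otimes> (y \<otimes> z))"
    if "x \<in> carrier G" "y \<in> carrier G" "z \<in> carrier G" for x y z
    using that sq[of x y] by (metis m_assoc m_closed)
  \<comment> \<open>Write x = x^-1 x^2; the central square x^2 moves past y and turns the second
    x^-1 into x.\<close>
  have swap: "x \<otimes> (y \<otimes> (inv x \<otimes> z)) = inv x \<otimes> (y \<otimes> (x \<otimes> z))"
    if "x \<in> carrier G" "y \<in> carrier G" "z \<in> carrier G" for x y z
  proof -
    have "x \<otimes> (y \<otimes> (inv x \<otimes> z)) = inv x \<otimes> (x \<otimes> (x \<otimes> (y \<otimes> (inv x \<otimes> z))))"
      using that by simp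
    also have "\<dots> = inv x \<otimes> (y \<otimes> (x \<otimes> z))"
      by (subst shift[symmetric]) (use that in simp_all)
    finally show ?thesis .
  qed
  \<comment> \<open>\<open>shift\<close> serves the cases \<open>r = YX\<close>, where squares are
    moved to the front; \<open>swap\<close> serves the cases \<open>r = XY\<close>, where x and x^-1
    change places around a factor.\<close>
  note simps = m_assoc inv_mult_group sq
  show "left_bol_loop (doubling_words G XY XiY XY XiY)"
    by (subst left_bol_doubling_words_iff) (simp_all add: simps swap)
  show "left_bol_loop (doubling_words G XY XY YX YX)"
    by (subst left_bol_doubling_words_iff) (simp_all add: simps shift)
  assume four: "powers G 4 = {\<one>}"
  have inv_sq: "inv x \<otimes> inv x = x \<otimes> x" if "x \<in> carrier G" for x
    using that four[unfolded powers_4_eq_one_iff] by metis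
  have inv_sq_left: "inv x \<otimes> (inv x \<otimes> z) = x \<otimes> (x \<otimes> z)" if "x \<in> carrier G" "z \<in> carrier G" for x z
    using that inv_sq[of x] by (metis inv_closed m_assoc)
  have inv_conj: "inv x \<otimes> (y \<otimes> (inv x \<otimes> z)) = x \<otimes> (y \<otimes> (x \<otimes> z))"
    if "x \<in> carrier G" "y \<in> carrier G" "z \<in> carrier G" for x y z
  proof -
    \<comment> \<open>Exponent 4 replaces the inner x^-1 by x^3; \<open>swap\<close> then moves the
      remaining inverse inwards, where it cancels.\<close>
    have "inv x \<otimes> (y \<otimes> (inv x \<otimes> z)) = inv x \<otimes> (y \<otimes> (x \<otimes> (x \<otimes> (x \<otimes> z))))"
      using that inv_sq_left[of x "x \<otimes> z"] by simp
    also have "\<dots> = x \<otimes> (y \<otimes> (x \<otimes> z))"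
      using that swap[of x y "x \<otimes> (x \<otimes> z)"] by simp
    finally show ?thesis .
  qed
  show "left_bol_loop (doubling_words G XY XY XY XiY)"
    by (subst left_bol_doubling_words_iff) (simp_all add: simps swap inv_conj)
  show "left_bol_loop (doubling_words G XY XY YX YXi)"
    by (subst left_bol_doubling_words_iff) (simp_all add: simps shift inv_sq inv_sq_left)
  show "left_bol_loop (doubling_words G XY XiY XY XY)"
    by (subst left_bol_doubling_words_iff) (simp_all add: simps swap inv_conj)
  show "left_bol_loop (doubling_words G XY XiY YX YX)"
    by (subst left_bol_doubling_words_iff) (simp_all add: simps shift inv_sq inv_sq_left)
qed

text \<open>For \<open>r = XY\<close>, z = 1 turns one of the equations into x y x^-1 = x^-1 y x
  (possibly with y^-1 for y), which says that x^2 and y commute. For \<open>r = YX\<close>, y = 1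
  directly makes x^2 commute with z.\<close>

lemma squares_central_if_left_bol:
  assumes "left_bol_loop (doubling_words G XY q r s)"
    and "(q, r, s) \<in> {(XiY, XY, XiY), (XY, YX, YX), (XY, XY, XiY), (XY, YX, YXi),
      (XiY, XY, XY), (XiY, YX, YX)}"
  shows "powers G 2 \<subseteq> center G"
  unfolding powers_2_subset_center_iff
proof (intro ballI)
  fix x y assume xy: "x \<in> carrier G" "y \<in> carrier G"
  have cancel: "x \<otimes> (x \<otimes> y) = y \<otimes> (x \<otimes> x)" if "x \<otimes> (y \<otimes> inv x) = inv x \<otimes> (y \<otimes> x)"
  proof -
    have "x \<otimes> (x \<otimes> y) = x \<otimes> (x \<otimes> (y \<otimes> inv x)) \<otimes> x"
      using xy by (simp add: m_assoc)
    also have "\<dots> = y \<otimes> (x \<otimes> x)"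
      using xy by (simp add: that m_assoc)
    finally show ?thesis .
  qed
  have "q \<in> {XY, YX, YXi, XiY}" "r \<in> {XY, YX}"
    using assms(2) by auto
  note bol = assms(1)[unfolded left_bol_doubling_words_iff[OF this], rule_format]
  from assms(2) consider "(q, r, s) \<in> {(XiY, XY, XiY), (XY, XY, XiY), (XiY, XY, XY)}"
    | "(q, r, s) \<in> {(XY, YX, YX), (XY, YX, YXi), (XiY, YX, YX)}"
    by auto
  then show "x \<otimes> (x \<otimes> y) = y \<otimes> (x \<otimes> x)"
  proof cases
    case 1
    then show ?thesis
      using xy bol[of x y \<one>] by (auto simp: m_assoc inv_mult_group intro!: cancel)
  next
    case 2
    then show ?thesis
      using xy bol[of x \<one> y] by (auto simp: m_assoc inv_mult_group)
  qed
qed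

text \<open>At y = z = 1 one of the equations reduces to x^2 = x^-2.\<close>

lemma exponent_4_if_left_bol:
  assumes "left_bol_loop (doubling_words G XY q r s)"
    and "(q, r, s) \<in> {(XY, XY, XiY), (XY, YX, YXi), (XiY, XY, XY), (XiY, YX, YX)}"
  shows "powers G 4 = {\<one>}"
  unfolding powers_4_eq_one_iff
proof
  fix x assume x: "x \<in> carrier G"
  have "q \<in> {XY, YX, YXi, XiY}" "r \<in> {XY, YX}"
    using assms(2) by auto
  note bol = assms(1)[unfolded left_bol_doubling_words_iff[OF this], rule_format]
  show "x \<otimes> x = inv x \<otimes> inv x"
    using x bol[of x \<one> \<one>] assms(2) by (auto simp: inv_mult_group)
qed

section \<open>The Moufang identity and flexibility\<close>

lemma moufang_chein: "moufang_loop (doubling_words G XY XiY YX YXi)"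
  unfolding moufang_loop_def
  by (simp add: is_loop_doubling_words[of XiY YX YXi, simplified] doubling_simps m_assoc inv_mult_group)

end

text \<open>This is the Moufang identity at z = 1.\<close>

lemma moufang_flexible:
  assumes "moufang_loop Q" and "x \<in> carrier Q" "y \<in> carrier Q"
  shows "(x \<otimes>\<^bsub>Q\<^esub> y) \<otimes>\<^bsub>Q\<^esub> x = x \<otimes>\<^bsub>Q\<^esub> (y \<otimes>\<^bsub>Q\<^esub> x)"
proof -
  have loop: "is_loop Q"
    using assms(1) unfolding moufang_loop_def by simp
  have moufang: "x \<otimes>\<^bsub>Q\<^esub> (y \<otimes>\<^bsub>Q\<^esub> (x \<otimes>\<^bsub>Q\<^esub> z)) = ((x \<otimes>\<^bsub>Q\<^esub> y) \<otimes>\<^bsub>Q\<^esub> x) \<otimes>\<^bsub>Q\<^esub> z"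
    if "z \<in> carrier Q" for z
    using assms that unfolding moufang_loop_def by simp
  have closed: "a \<otimes>\<^bsub>Q\<^esub> b \<in> carrier Q" if "a \<in> carrier Q" "b \<in> carrier Q" for a b
    using loop that by (simp add: is_loop_def quasigroup_def)
  have one: "\<one>\<^bsub>Q\<^esub> \<in> carrier Q" "\<And>a. a \<in> carrier Q \<Longrightarrow> a \<otimes>\<^bsub>Q\<^esub> \<one>\<^bsub>Q\<^esub> = a"
    using loop by (simp_all add: is_loop_def)
  show ?thesis
    using moufang[OF one(1)] assms(2,3) by (simp add: one(2) closed)
qed

lemma left_bol_if_moufang: "moufang_loop Q \<Longrightarrow> left_bol_loop Q"
  using moufang_flexible[of Q] by (simp add: moufang_loop_def left_bol_loop_def)

lemma moufang_if_group:
  assumes "group Q"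
  shows "moufang_loop Q"
proof -
  interpret Q: group Q by fact
  show ?thesis
    unfolding moufang_loop_def is_loop_def quasigroup_def
    by (simp add: Q.m_assoc Q.ex1_mult_left Q.ex1_mult_right)
qed

context group
begin

text \<open>Flexibility for the pairs (g', h) and (g, h'), a prime marking the second copy; it is
  what \<open>not_moufang\<close> contradicts.\<close>

lemma flexible_if_moufang:
  assumes "moufang_loop (doubling_words G XY q r s)" "g \<in> carrier G" "h \<in> carrier G"
  shows "theta G s (theta G r g h) g = theta G s g (theta G q h g)"
    and "theta G r (theta G q g h) g = theta G q g (theta G r h g)"
  using moufang_flexible[OF assms(1), of "Inr g" "Inl h"]
    moufang_flexible[OF assms(1), of "Inl g" "Inr h"] assms(2,3)
  by (simp_all add: doubling_simps InlI InrI)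

lemma not_moufang:
  assumes "\<not> comm_group G"
    and "(q, r, s) \<in> {(XiY, XY, XiY), (XY, YX, YX), (XY, XY, XiY), (XY, YX, YXi),
      (XiY, XY, XY), (XiY, YX, YX)}"
  shows "\<not> moufang_loop (doubling_words G XY q r s)"
proof
  assume M: "moufang_loop (doubling_words G XY q r s)"
  obtain a b where ab: "a \<in> carrier G" "b \<in> carrier G" "a \<otimes> b \<noteq> b \<otimes> a"
    using ex_noncommuting[OF assms(1)] .
  obtain c where c: "c \<in> carrier G" "inv c \<noteq> c"
    using ex_not_involution[OF assms(1)] .
  have conj: "b \<noteq> inv a \<otimes> (b \<otimes> a)"
    using ab inv_solve_left[of b a "b \<otimes> a"] by simp
  have comm: "a \<otimes> (b \<otimes> a) \<noteq> b \<otimes> (a \<otimes> a)"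
    using ab by (simp flip: m_assoc)
  \<comment> \<open>The first two triples fail at the noncommuting pair, with \<open>inv b\<close>
    for b where the equation inverts h; the other four fail at g = 1, h = \<open>c\<close>, where
    flexibility would give c^-1 = c.\<close>
  show False
    using assms(2) conj comm flexible_if_moufang[OF M ab(1,2)] flexible_if_moufang[OF M ab(1) inv_closed[OF ab(2)]]
      flexible_if_moufang[OF M one_closed c(1)] flexible_if_moufang[OF M c(1) one_closed] ab c
    by (auto simp: m_assoc inv_mult_group)
qed

lemma not_associative:
  assumes "\<not> comm_group G"
  shows "\<not> associative (doubling_words G XY XiY YX YXi)"
proof
  assume "associative (doubling_words G XY XiY YX YXi)"
  moreover obtain a b where ab: "a \<in> carrier G" "b \<in> carrier G" "a \<otimes> b \<noteq> b \<otimes> a"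
    using ex_noncommuting[OF assms] .
  \<comment> \<open>Associativity for g, h and the copy of k reads (gh)^-1 k = g^-1 (h^-1 k); take k
    = 1.\<close>
  ultimately have "inv (a \<otimes> b) = inv a \<otimes> inv b"
    unfolding associative_def by (simp add: doubling_simps) (metis m_closed inv_closed one_closed r_one)
  then show False
    using ab by (metis inv_inv inv_closed inv_mult_group m_closed)
qed

text \<open>This is the direct product of G with the group of order 2.\<close>

lemma group_doubling_words: "group (doubling_words G XY XY XY XY)"
proof (rule groupI)
  have "\<forall>u\<in>carrier (doubling_words G XY XY XY XY). \<exists>v\<in>carrier (doubling_words G XY XY XY XY).
      v \<otimes>\<^bsub>doubling_words G XY XY XY XY\<^esub> u = \<one>\<^bsub>doubling_words G XY XY XY XY\<^esub>"
    by (simp add: doubling_simps bex_Plus l_inv_ex)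
  then show "\<exists>v\<in>carrier (doubling_words G XY XY XY XY).
      v \<otimes>\<^bsub>doubling_words G XY XY XY XY\<^esub> u = \<one>\<^bsub>doubling_words G XY XY XY XY\<^esub>"
    if "u \<in> carrier (doubling_words G XY XY XY XY)" for u
    using that by blast
qed (auto simp: doubling_simps m_assoc)

lemma doubling_words_iso_chein_loop: "doubling_words G XY XiY YX YXi \<cong> chein_loop G"
proof -
  \<comment> \<open>Inversion on the second copy undoes itself on the carrier, so the same map is
    the witness for bijectivity.\<close>
  have "map_sum id (m_inv G) \<in> iso (doubling_words G XY XiY YX YXi) (chein_loop G)"
    unfolding iso_def hom_def chein_loop_def
    by (auto simp: doubling_simps inv_mult_group
        intro!: bij_betw_byWitness[where f' = "map_sum id (m_inv G)"])
  then show ?thesis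
    unfolding is_iso_def by blast
qed

lemma moufang_doubling_words_imp:
  assumes "\<not> comm_group G" "q \<in> {XY, YX, YXi, XiY}" "r \<in> {XY, YX}"
    and "moufang_loop (doubling_words G XY q r s)"
  shows "(q, r, s) \<in> {(XY, XY, XY), (XiY, YX, YXi)}"
  using left_bol_doubling_words_imp[OF assms(1-3) left_bol_if_moufang[OF assms(4)]]
    not_moufang[OF assms(1), of q r s] assms(4)
  by auto

end

lemma associative_if_group:
  assumes "group Q"
  shows "associative Q"
proof -
  interpret Q: group Q by fact
  show ?thesis
    by (simp add: associative_def Q.m_assoc)
qed

section \<open>The classification\<close>

theorem theorem6p2:
  fixes G :: "('a, 'b) monoid_scheme"
    and \<alpha> \<beta> \<gamma> \<delta> :: "'a \<Rightarrow> 'a \<Rightarrow> 'a"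
    and M :: "('a + 'a) monoid"
  assumes "group G" and "finite (carrier G)" and "\<not> comm_group G"
    and "\<alpha> = theta G XY"
    and "\<beta> \<in> {theta G XY, theta G YX, theta G YXi, theta G XiY}"
    and "\<gamma> \<in> {theta G XY, theta G YX}"
    and "\<delta> \<in> {theta G XY, theta G XYi, theta G XiY, theta G XiYi,
              theta G YX, theta G YXi, theta G YiX, theta G YiXi}"
    and "M = doubling G \<alpha> \<beta> \<gamma> \<delta>"
  shows
    "(group M \<longleftrightarrow> M = doubling_words G XY XY XY XY) \<and>
     ((moufang_loop M \<and> \<not> associative M \<longleftrightarrow> M = doubling_words G XY XiY YX YXi) \<and>
      (M = doubling_words G XY XiY YX YXi \<longrightarrow> M \<cong> chein_loop G)) \<and>
     (left_bol_loop M \<and> \<not> moufang_loop M \<longleftrightarrow>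
        (powers G 2 \<subseteq> center G \<and>
         M \<in> {doubling_words G XY XiY XY XiY,
               doubling_words G XY XY YX YX}) \<or>
        (powers G 2 \<subseteq> center G \<and> powers G 4 = {\<one>\<^bsub>G\<^esub>} \<and>
         M \<in> {doubling_words G XY XY XY XiY,
               doubling_words G XY XY YX YXi,
               doubling_words G XY XiY XY XY,
               doubling_words G XY XiY YX YX}))"
proof -
  interpret group G by fact
  note nonab = assms(3)
  obtain q where \<beta>: "\<beta> = theta G q" and q: "q \<in> {XY, YX, YXi, XiY}"
    using assms(5) by blast
  obtain r where \<gamma>: "\<gamma> = theta G r" and r: "r \<in> {XY, YX}"
    using assms(6) by blast
  obtain s where \<delta>: "\<delta> = theta G s"
    using assms(7) by blast
  have M: "M = doubling_words G XY q r s"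
    by (simp only: assms(4,8) \<beta> \<gamma> \<delta>)
  have moufang_cases: "M = doubling_words G XY XY XY XY \<or> M = doubling_words G XY XiY YX YXi"
    if "moufang_loop M"
    using moufang_doubling_words_imp[OF nonab q r that[unfolded M]] by (auto simp: M simp del: theta.simps)
  have moufang: "moufang_loop M"
    if "M = doubling_words G XY XY XY XY \<or> M = doubling_words G XY XiY YX YXi"
    using that moufang_if_group[OF group_doubling_words] moufang_chein by metis
  \<comment> \<open>A group is Moufang, which leaves two candidates, and the second is not
    associative.\<close>
  have 1: "group M \<longleftrightarrow> M = doubling_words G XY XY XY XY"
    using moufang_cases moufang_if_group associative_if_group not_associative[OF nonab]
      group_doubling_words by metis
  have 2: "moufang_loop M \<and> \<not> associative M \<longleftrightarrow> M = doubling_words G XY XiY YX YXi"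
    using moufang_cases moufang associative_if_group[OF group_doubling_words]
      not_associative[OF nonab] by metis
  let ?A = "{(XiY, XY, XiY), (XY, YX, YX)}"
  let ?B = "{(XY, XY, XiY), (XY, YX, YXi), (XiY, XY, XY), (XiY, YX, YX)}"
  let ?W = "\<lambda>(q, r, s). doubling_words G XY q r s"
  have 3: "left_bol_loop M \<and> \<not> moufang_loop M \<longleftrightarrow>
      powers G 2 \<subseteq> center G \<and> M \<in> ?W ` ?A \<or>
      powers G 2 \<subseteq> center G \<and> powers G 4 = {\<one>\<^bsub>G\<^esub>} \<and> M \<in> ?W ` ?B" (is "?L \<longleftrightarrow> ?R")
  proof
    assume L: ?L
    then have bol: "left_bol_loop (doubling_words G XY q r s)"
      by (simp only: M)
    \<comment> \<open>Of the eight triples that survive the left Bol identity, these two give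
      Moufang loops.\<close>
    have "(q, r, s) \<notin> {(XY, XY, XY), (XiY, YX, YXi)}"
      using L moufang M by auto
    then consider "(q, r, s) \<in> ?A" | "(q, r, s) \<in> ?B"
      using left_bol_doubling_words_imp[OF nonab q r bol] by auto
    moreover have W: "M \<in> ?W ` X" if "(q, r, s) \<in> X" for X
      by (rule image_eqI[OF _ that]) (simp only: M prod.case)
    ultimately show ?R
    proof cases
      case 1
      then show ?thesis
        using W[OF 1] 1 squares_central_if_left_bol[OF bol] by auto
    next
      case 2
      then show ?thesis
        using W[OF 2] 2 squares_central_if_left_bol[OF bol] exponent_4_if_left_bol[OF bol 2]
        by auto
    qed
  next
    assume R: ?R
    then have "M \<in> ?W ` (?A \<union> ?B)"
      unfolding image_Un by blast
    \<comment> \<open>The triple is taken from the membership and not identified with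
      \<open>(q, r, s)\<close>, so it need not be shown that distinct words give distinct
      operations.\<close>
    then obtain t where "M = ?W t" "t \<in> ?A \<union> ?B"
      by (rule imageE)
    moreover obtain q' r' s' where "t = (q', r', s')"
      by (rule prod_cases3)
    ultimately have "M = doubling_words G XY q' r' s'" "(q', r', s') \<in> ?A \<union> ?B"
      by (simp_all only: prod.case)
    then have "\<not> moufang_loop M"
      using not_moufang[OF nonab, of q' r' s'] by blast
    moreover have "left_bol_loop M"
      using R left_bol_if_squares_central by (auto simp del: theta.simps)
    ultimately show ?L
      by blast
  qed
  from 1 2 3 doubling_words_iso_chein_loop show ?thesis
    by (simp del: theta.simps)
qed

end
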